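(* Let $X$ be a Cantor space. If $f \in C_s(X)$ is of residual type then $f \in H(X)$.
   Context: A Cantor space is a nonempty, compact, zero-dimensional, perfect metric space. $C_s(X)$ is the space of continuous surjections $X\to X$ with the sup metric; $H(X) \subset C_s(X)$ is the group of homeomorphisms of $X$. The conjugacy class of $f \in C_s(X)$ is $\{h\circ f\circ h^{-1} : h \in H(X)\}$. A map $f \in C_s(X)$ is of residual type if its conjugacy class is a $G_\delta$ subset of $C_s(X)$. *)

theory Defs
  imports "HOL-Analysis.Analysis"
begin

text \<open>
  The metric space is the whole type, so it is nonempty automatically.
  Zero-dimensional means having a base of clopen sets; the lemma below relates this to the
  library's small inductive dimension, which is not available inside a class specification.
\<close>

class cantor_space = metric_space + perfect_space +
  assumes compact_UNIV_cantor: "compact (UNIV :: 'a set)"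
    and zero_dimensional_cantor:
      "open V \<Longrightarrow> x \<in> V \<Longrightarrow> \<exists>U. open U \<and> closed U \<and> x \<in> U \<and> U \<subseteq> V"

lemma dim_le_0_iff_clopen_base:
  "(euclidean :: 'a::topological_space topology) dim_le 0 \<longleftrightarrow>
    (\<forall>V (x::'a). open V \<longrightarrow> x \<in> V \<longrightarrow> (\<exists>U. open U \<and> closed U \<and> x \<in> U \<and> U \<subseteq> V))"
proof -
  have "(euclidean :: 'a topology) dim_le 0 \<longleftrightarrow>
    (\<forall>V (x::'a). openin euclidean V \<and> x \<in> V \<longrightarrow>
      (\<exists>U. (closedin euclidean U \<and> openin euclidean U) \<and> x \<in> U \<and> U \<subseteq> V))"
    unfolding dimension_le_0_neighbourhood_base_of_clopen
    by (rule open_neighbourhood_base_of) simp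
  also have "\<dots> \<longleftrightarrow> (\<forall>V (x::'a). open V \<longrightarrow> x \<in> V \<longrightarrow> (\<exists>U. open U \<and> closed U \<and> x \<in> U \<and> U \<subseteq> V))"
    by (simp add: conj_ac imp_conjL)
  finally show ?thesis .
qed

text \<open>
  On a compact space every continuous map is bounded, so the type of bounded continuous
  functions contains all continuous self-maps, and its distance is the sup metric.
\<close>

definition Cs :: "('a::metric_space \<Rightarrow>\<^sub>C 'a) set" where
  "Cs = {f. surj (apply_bcontfun f)}"

definition homeos :: "('a::metric_space \<Rightarrow>\<^sub>C 'a) set" where
  "homeos = {h. \<exists>k. homeomorphism UNIV UNIV (apply_bcontfun h) k}"

definition conj_class :: "('a::metric_space \<Rightarrow>\<^sub>C 'a) \<Rightarrow> ('a \<Rightarrow>\<^sub>C 'a) set" where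
  "conj_class f =
     {g. \<exists>h\<in>homeos. apply_bcontfun g = apply_bcontfun h \<circ> apply_bcontfun f \<circ> inv (apply_bcontfun h)}"

definition residual_type :: "('a::metric_space \<Rightarrow>\<^sub>C 'a) \<Rightarrow> bool" where
  "residual_type f \<longleftrightarrow> f \<in> Cs \<and> gdelta_in (top_of_set Cs) (conj_class f)"

end

theory Submission
  imports Defs
begin

text \<open>
  Conjugating \<open>f\<close> by a homeomorphism \<open>h\<close> that is uniformly close to \<open>f\<close> itself has two effects.
  First, \<open>h \<circ> f \<circ> h\<inverse>\<close> is close to \<open>f \<circ> f \<circ> h\<inverse>\<close>, hence by uniform continuity of \<open>f\<close> close to
  \<open>f \<circ> h \<circ> h\<inverse> = f\<close>. Second, its fibre over \<open>h z\<close> is \<open>h (f\<inverse> z)\<close>, which lies in a small ball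
  around \<open>z\<close>, because \<open>h x\<close> is close to \<open>f x = z\<close> for every \<open>x\<close> in the fibre. So the conjugacy
  class \<open>C\<close> of \<open>f\<close> has, arbitrarily close to each of its members, further members all of whose
  fibres are as small as desired (\<open>separating_conjugate_nearby\<close>).

  If \<open>C\<close> is a \<open>G\<^sub>\<delta>\<close> set, it is a dense \<open>G\<^sub>\<delta>\<close> in its closure, which is completely metrizable. The
  maps with fibres of diameter less than \<open>1/(n+1)\<close> form an open set whose part in \<open>C\<close> is dense in \<open>C\<close>. By
  Baire's theorem (\<open>gdelta_meets_dense_opens\<close>) some member of \<open>C\<close> lies in all of these open sets.
  It is injective, hence a homeomorphism by compactness, and so is its conjugate \<open>f\<close>.

  The remaining ingredient is that every continuous surjection of a Cantor space onto itself is a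
  uniform limit of homeomorphisms (\<open>homeomorphism_near_surjection\<close>): cut the target into small
  clopen sets \<open>V\<close> and map each \<open>f\<inverse> V\<close> homeomorphically onto \<open>V\<close>. This rests on Brouwer's theorem
  that any two nonempty clopen subsets are homeomorphic (\<open>clopen_homeomorphic\<close>).
\<close>

section \<open>Cantor spaces as compact spaces with many clopen sets\<close>

text \<open>
  Metric spaces whose bounded closed sets are compact are complete, so this makes the space of bounded continuous self-maps complete, as Baire's theorem requires.
\<close>

instance cantor_space \<subseteq> heine_borel
proof
  fix f :: "nat \<Rightarrow> 'a"
  show "\<exists>l r. strict_mono r \<and> (f \<circ> r) \<longlonglongrightarrow> l"
    using compact_imp_seq_compact[OF compact_UNIV_cantor] unfolding seq_compact_def by blast
qed

abbreviation clopen :: "'a::topological_space set \<Rightarrow> bool" where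
  "clopen S \<equiv> open S \<and> closed S"

lemma small_clopen_cover:
  fixes e :: real
  assumes "e > 0"
  obtains U :: "nat \<Rightarrow> 'a::cantor_space set"
  where "\<And>n. clopen (U n)" "\<And>n x y. x \<in> U n \<Longrightarrow> y \<in> U n \<Longrightarrow> dist x y < e" "(\<Union>n. U n) = UNIV"
proof -
  define F where "F = {U :: 'a set. clopen U \<and> (\<forall>x\<in>U. \<forall>y\<in>U. dist x y < e)}"
  have "\<exists>U\<in>F. x \<in> U" for x
  proof -
    obtain U where U: "open U" "closed U" "x \<in> U" "U \<subseteq> ball x (e/2)"
      using zero_dimensional_cantor[of "ball x (e/2)" x] assms by auto
    have "dist y z < e" if "y \<in> U" "z \<in> U" for y z
      using that U(4) dist_triangle_half_r[of x y e z] by (auto simp: subset_iff)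
    then show ?thesis using U by (auto simp: F_def)
  qed
  then have "UNIV \<subseteq> \<Union>F" "\<And>B. B \<in> F \<Longrightarrow> open B" by (auto simp: F_def)
  then obtain F' where F': "F' \<subseteq> F" "finite F'" "UNIV \<subseteq> \<Union>F'"
    using compactE[OF compact_UNIV_cantor] by metis
  then have "F' \<noteq> {}" by auto
  then have r: "range (from_nat_into F') = F'"
    using F'(2) by (simp add: countable_finite range_from_nat_into)
  have mem: "from_nat_into F' n \<in> F" for n
    using r F'(1) by blast
  show ?thesis
  proof (rule that[of "from_nat_into F'"])
    show "clopen (from_nat_into F' n)" for n
      using mem by (simp add: F_def)
    show "dist x y < e" if "x \<in> from_nat_into F' n" "y \<in> from_nat_into F' n" for n x y
      using mem that unfolding F_def by blast
    show "(\<Union>n. from_nat_into F' n) = UNIV"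
      using r F'(3) by auto
  qed
qed

lemma separating_clopen_sequence:
  obtains U :: "nat \<Rightarrow> 'a::cantor_space set"
  where "\<And>n. clopen (U n)" "\<And>x y. x \<noteq> y \<Longrightarrow> \<exists>n. x \<in> U n \<and> y \<notin> U n"
proof -
  have "\<exists>V :: nat \<Rightarrow> 'a set. (\<forall>n. clopen (V n)) \<and>
      (\<forall>n. \<forall>x\<in>V n. \<forall>y\<in>V n. dist x y < inverse (real (Suc m))) \<and> (\<Union>n. V n) = UNIV" for m
  proof -
    have "0 < inverse (real (Suc m))" by simp
    from small_clopen_cover[OF this] obtain V :: "nat \<Rightarrow> 'a set" where
      "\<And>n. clopen (V n)" "\<And>n x y. x \<in> V n \<Longrightarrow> y \<in> V n \<Longrightarrow> dist x y < inverse (real (Suc m))"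
      "(\<Union>n. V n) = UNIV"
      by metis
    then show ?thesis by blast
  qed
  then obtain V :: "nat \<Rightarrow> nat \<Rightarrow> 'a set" where V:
    "\<And>m n. clopen (V m n)"
    "\<And>m n x y. x \<in> V m n \<Longrightarrow> y \<in> V m n \<Longrightarrow> dist x y < inverse (real (Suc m))"
    "\<And>m. (\<Union>n. V m n) = UNIV"
    by metis
  show ?thesis
  proof (rule that[of "\<lambda>k. V (fst (prod_decode k)) (snd (prod_decode k))"])
    show "clopen (V (fst (prod_decode k)) (snd (prod_decode k)))" for k
      by (rule V(1))
    fix x y :: 'a assume "x \<noteq> y"
    then obtain m where m: "inverse (real (Suc m)) < dist x y"
      using reals_Archimedean[of "dist x y"] by auto
    obtain n where "x \<in> V m n" using V(3)[of m] by blast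
    moreover have "y \<notin> V m n" using V(2)[of x m n y] m \<open>x \<in> V m n\<close> by auto
    ultimately show "\<exists>k. x \<in> V (fst (prod_decode k)) (snd (prod_decode k)) \<and>
        y \<notin> V (fst (prod_decode k)) (snd (prod_decode k))"
      by (intro exI[of _ "prod_encode (m, n)"]) simp
  qed
qed

lemma clopen_proper_subset:
  fixes A :: "'a::cantor_space set"
  assumes "open A" "A \<noteq> {}"
  shows "\<exists>B. clopen B \<and> A \<inter> B \<noteq> {} \<and> A - B \<noteq> {}"
proof -
  obtain x where x: "x \<in> A" using assms by auto
  have "A \<noteq> {x}" using assms(1) not_open_singleton by auto
  then obtain y where y: "y \<in> A" "y \<noteq> x" using x by auto
  obtain B where "open B" "closed B" "x \<in> B" "B \<subseteq> - {y}"
    using zero_dimensional_cantor[of "- {y}" x] y by auto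
  then show ?thesis using x y by (intro exI[of _ B]) auto
qed

section \<open>Nonempty clopen sets are homeomorphic to the space of binary sequences\<close>

text \<open>
  Repeatedly cutting a clopen set \<open>W\<close> into two nonempty clopen halves labels its points by binary
  sequences. The cut of a cell \<open>A\<close> at stage \<open>n\<close> is along \<open>D = U n\<close> whenever \<open>U n\<close> really divides
  \<open>A\<close>, so that in the end the labels separate points. Otherwise it is along an arbitrary clopen set
  that divides \<open>A\<close>, so that every binary sequence occurs as a label.
\<close>

definition splitter :: "'a::cantor_space set \<Rightarrow> 'a set \<Rightarrow> 'a set" where
  "splitter D A = (SOME B. clopen B \<and> A \<inter> B \<noteq> {} \<and> A - B \<noteq> {} \<and>
     (A \<inter> D \<noteq> {} \<longrightarrow> A - D \<noteq> {} \<longrightarrow> B = D))"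

lemma splitter:
  assumes "open A" "A \<noteq> {}" "clopen D"
  shows "clopen (splitter D A)" "A \<inter> splitter D A \<noteq> {}" "A - splitter D A \<noteq> {}"
    "A \<inter> D \<noteq> {} \<Longrightarrow> A - D \<noteq> {} \<Longrightarrow> splitter D A = D"
proof -
  have "\<exists>B. clopen B \<and> A \<inter> B \<noteq> {} \<and> A - B \<noteq> {} \<and> (A \<inter> D \<noteq> {} \<longrightarrow> A - D \<noteq> {} \<longrightarrow> B = D)"
    using clopen_proper_subset[OF assms(1,2)] assms(3) by metis
  from someI_ex[OF this, folded splitter_def]
  show "clopen (splitter D A)" "A \<inter> splitter D A \<noteq> {}" "A - splitter D A \<noteq> {}"
    "A \<inter> D \<noteq> {} \<Longrightarrow> A - D \<noteq> {} \<Longrightarrow> splitter D A = D"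
    by auto
qed

locale clopen_coding =
  fixes U :: "nat \<Rightarrow> 'a::cantor_space set" and W :: "'a set"
  assumes clopen_seq: "\<And>n. clopen (U n)"
    and separates: "\<And>x y. x \<noteq> y \<Longrightarrow> \<exists>n. x \<in> U n \<and> y \<notin> U n"
    and clopen_W: "clopen W"
    and nonempty_W: "W \<noteq> {}"
begin

primrec cell :: "(nat \<Rightarrow> bool) \<Rightarrow> nat \<Rightarrow> 'a set" where
  "cell s 0 = W"
| "cell s (Suc n) =
     (if s n then cell s n \<inter> splitter (U n) (cell s n)
      else cell s n - splitter (U n) (cell s n))"

text \<open>
  \<open>cell\<close> follows a prescribed binary sequence down the tree of cuts, whereas \<open>node\<close> follows a point.
  They meet in \<open>cell_code\<close>; the former serves for surjectivity of the coding, the latter for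
  continuity and injectivity.
\<close>

primrec node :: "'a \<Rightarrow> nat \<Rightarrow> 'a set" where
  "node x 0 = W"
| "node x (Suc n) =
     (if x \<in> splitter (U n) (node x n) then node x n \<inter> splitter (U n) (node x n)
      else node x n - splitter (U n) (node x n))"

definition code :: "'a \<Rightarrow> nat \<Rightarrow> bool" where
  "code x n \<longleftrightarrow> x \<in> splitter (U n) (node x n)"

lemma cell_code: "cell (code x) n = node x n"
  by (induction n) (auto simp: code_def)

lemma cell_clopen_nonempty:
  shows "clopen (cell s n) \<and> cell s n \<noteq> {}"
proof (induction n)
  case (Suc n)
  then have "open (cell s n)" "cell s n \<noteq> {}" by auto
  from splitter[OF this clopen_seq[of n]] Suc show ?case
    by (simp add: open_Int closed_Int open_Diff closed_Diff)
qed (use clopen_W nonempty_W in auto)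

lemma cell_antimono: "m \<le> n \<Longrightarrow> cell s n \<subseteq> cell s m"
  by (rule lift_Suc_antimono_le[of "cell s"]) auto

lemma mem_node: "x \<in> W \<Longrightarrow> x \<in> node x n"
  by (induction n) auto

lemma node_eq_if_mem: "y \<in> node x n \<Longrightarrow> node y n = node x n"
  by (induction n) (auto split: if_splits)

lemma code_eq_if_mem_node:
  assumes "y \<in> node x (Suc n)"
  shows "code y n = code x n"
proof -
  have "y \<in> node x n" using assms by (auto split: if_splits)
  then show ?thesis
    using assms node_eq_if_mem by (auto simp: code_def split: if_splits)
qed

text \<open>
  Each binary digit is locally constant, since it is constant on the open cell of the next level.
  The digits are read as real numbers because sequences of reals carry a metric, which makes the
  target a Hausdorff space.
\<close>

lemma code_continuous:
  shows "continuous_on W (\<lambda>x n. of_bool (code x n) :: real)"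
proof (rule continuous_on_coordinatewise_then_product)
  fix n
  show "continuous_on W (\<lambda>x. of_bool (code x n) :: real)"
    unfolding continuous_on_eq_continuous_within
  proof
    fix x assume x: "x \<in> W"
    have op: "open (node x (Suc n))"
      using cell_clopen_nonempty[of "code x" "Suc n"] unfolding cell_code by simp
    have "continuous_on (node x (Suc n)) (\<lambda>y. of_bool (code y n) :: real)"
      using code_eq_if_mem_node[of _ x n]
      by (subst continuous_on_cong[OF refl, where g = "\<lambda>_. of_bool (code x n)"]) auto
    then have "isCont (\<lambda>y. of_bool (code y n) :: real) x"
      using op mem_node[OF x, of "Suc n"] continuous_on_eq_continuous_at by blast
    then show "continuous (at x within W) (\<lambda>y. of_bool (code y n) :: real)"
      by (rule continuous_at_imp_continuous_within)
  qed
qed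

text \<open>
  If \<open>U n\<close> separates two points that still share a cell at level \<open>n\<close>, then \<open>U n\<close> divides that cell
  and is itself the cut used there, so the points get different \<open>n\<close>-th digits.
\<close>

lemma code_inj:
  shows "inj_on (code) W"
proof (rule inj_onI, rule ccontr)
  fix x y assume xy: "x \<in> W" "y \<in> W" "code x = code y" "x \<noteq> y"
  then obtain n where n: "x \<in> U n" "y \<notin> U n" using separates by blast
  have eq: "node x n = node y n" by (metis cell_code xy(3))
  have op: "open (node x n)" "node x n \<noteq> {}"
    using cell_clopen_nonempty[of "code x" n] unfolding cell_code by simp_all
  have mem: "x \<in> node x n" "y \<in> node x n" using mem_node xy eq by metis+
  have "splitter (U n) (node x n) = U n"
    by (rule splitter(4)[OF op clopen_seq]) (use n mem in auto)
  then show False using xy(3) n eq unfolding code_def by metis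
qed

text \<open>
  The cells along a binary sequence are nested, nonempty and compact. Any common point has that
  sequence as its code.
\<close>

lemma code_surj:
  shows "code ` W = UNIV"
proof -
  have "\<exists>x\<in>W. code x = s" for s
  proof -
    have ne: "cell s n \<noteq> {}" and co: "compact (cell s n)" for n
      using cell_clopen_nonempty[of s n] closed_Int_compact[OF _ compact_UNIV_cantor]
      by fastforce+
    obtain x where x: "x \<in> cell s n" for n
      using compact_nest[of "cell s", OF co ne cell_antimono] by blast
    have node: "node x n = cell s n" for n
      using x by (induction n) (auto, (metis cell.simps(2) DiffD2 IntD2)+)
    have "code x n = s n" for n
      using x[of "Suc n"] by (auto simp: code_def node split: if_splits)
    then show ?thesis using x[of 0] by auto
  qed
  then show ?thesis by (metis UNIV_eq_I imageI)
qed

end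

text \<open>
  This is the form of Brouwer's characterization of the Cantor set needed below: both sets are
  homeomorphic to the same space of binary sequences, by the coding along one fixed separating
  sequence of clopen sets.
\<close>

theorem clopen_homeomorphic:
  fixes V W :: "'a::cantor_space set"
  assumes "clopen V" "V \<noteq> {}" "clopen W" "W \<noteq> {}"
  shows "V homeomorphic W"
proof -
  define E where "E = (\<lambda>(s :: nat \<Rightarrow> bool) n. of_bool (s n) :: real)"
  obtain U :: "nat \<Rightarrow> 'a set"
    where U: "\<And>n. clopen (U n)" "\<And>x y. x \<noteq> y \<Longrightarrow> \<exists>n. x \<in> U n \<and> y \<notin> U n"
    using separating_clopen_sequence by blast
  have "inj E" by (auto simp: E_def inj_def fun_eq_iff)
  have *: "A homeomorphic range E" if A: "clopen A" "A \<noteq> {}" for A :: "'a set"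
  proof -
    interpret clopen_coding U A
      using U A by unfold_locales auto
    show ?thesis
    proof (rule homeomorphic_compact)
      show "compact A"
        using A(1) closed_Int_compact[OF _ compact_UNIV_cantor, of A] by simp
      show "continuous_on A (\<lambda>x. E (code x))"
        unfolding E_def by (rule code_continuous)
      show "(\<lambda>x. E (code x)) ` A = range E"
        using code_surj by (metis image_image)
      show "inj_on (\<lambda>x. E (code x)) A"
        using code_inj \<open>inj E\<close> by (auto simp: inj_on_def)
    qed
  qed
  show ?thesis
    using *[OF assms(1,2)] *[OF assms(3,4)] homeomorphic_sym homeomorphic_trans by blast
qed

section \<open>Homeomorphisms are dense among the continuous surjections\<close>

text \<open>
  Disjoint clopen sets \<open>V n\<close> of small diameter cover the space. Surjectivity of \<open>f\<close> makes \<open>f\<inverse> (V n)\<close>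
  nonempty exactly when \<open>V n\<close> is, so homeomorphisms \<open>f\<inverse> (V n) \<rightarrow> V n\<close> exist and can be glued. The
  result \<open>h\<close> is close to \<open>f\<close> because \<open>h x\<close> and \<open>f x\<close> always lie in the same \<open>V n\<close>.
\<close>

lemma homeomorphism_near_surjection:
  fixes f :: "'a::cantor_space \<Rightarrow> 'a"
  assumes f: "continuous_on UNIV f" "surj f" and "e > 0"
  obtains h k where "homeomorphism UNIV UNIV h k" "\<And>x. dist (h x) (f x) < e"
proof -
  obtain U :: "nat \<Rightarrow> 'a set" where U: "\<And>n. clopen (U n)"
    "\<And>n x y. x \<in> U n \<Longrightarrow> y \<in> U n \<Longrightarrow> dist x y < e" "(\<Union>n. U n) = UNIV"
    using small_clopen_cover[OF \<open>e > 0\<close>] by blast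
  define V where "V = disjointed U"
  have V_clopen: "clopen (V n)" for n
    unfolding V_def disjointed_def using U(1) by (auto intro!: open_Diff closed_Diff)
  have V_disj: "m = n" if "x \<in> V m" "x \<in> V n" for x m n
    using that disjoint_family_disjointed[of U] unfolding V_def disjoint_family_on_def by blast
  have "(\<Union>n. V n) = UNIV" unfolding V_def UN_disjointed_eq by (rule U(3))
  then obtain i where i: "\<And>x. x \<in> V (i x)" by (metis UNIV_I UN_E)
  have i_eq: "i x = n" if "x \<in> V n" for x n using V_disj[OF i that] .
  have pre_clopen: "clopen (f -` V n)" for n
    using V_clopen[of n] f(1) by (auto intro: open_vimage closed_vimage)
  have "f -` V n homeomorphic V n" for n
  proof (cases "V n = {}")
    case False
    then have "f -` V n \<noteq> {}" using f(2) by (metis image_vimage_eq image_empty inf_top.right_neutral)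
    then show ?thesis using clopen_homeomorphic pre_clopen V_clopen False by blast
  qed (simp add: homeomorphic_refl)
  then obtain p q where pq: "\<And>n. homeomorphism (f -` V n) (V n) (p n) (q n)"
    unfolding homeomorphic_def by metis
  define h where "h x = p (i (f x)) x" for x
  have h_on: "h x = p n x" if "f x \<in> V n" for x n using i_eq[OF that] by (simp add: h_def)
  have h_mem: "h x \<in> V n \<longleftrightarrow> f x \<in> V n" for x n
  proof -
    have "p (i (f x)) ` (f -` V (i (f x))) = V (i (f x))" using pq by (simp add: homeomorphism_def)
    then have "h x \<in> V (i (f x))" using i[of "f x"] by (auto simp: h_def)
    then show ?thesis using V_disj i by metis
  qed
  have "continuous_on (f -` V n) h" for n
  proof -
    have "continuous_on (f -` V n) (p n)" using pq by (simp add: homeomorphism_def)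
    then show ?thesis using h_on by (subst continuous_on_cong[OF refl, of _ h "p n"]) auto
  qed
  then have "continuous_on (\<Union>n. f -` V n) h"
    using pre_clopen by (intro continuous_on_open_UN) auto
  moreover have "(\<Union>n. f -` V n) = UNIV" using i by blast
  ultimately have cont: "continuous_on UNIV h" by simp
  have "inj h"
  proof (rule injI)
    fix x y assume eq: "h x = h y"
    define n where "n = i (f x)"
    have x: "f x \<in> V n" unfolding n_def by (rule i)
    then have y: "f y \<in> V n" using h_mem eq by metis
    have "inj_on (p n) (f -` V n)" using pq by (metis homeomorphism_apply1 inj_on_inverseI)
    then show "x = y" using eq h_on[OF x] h_on[OF y] x y by (auto simp: inj_on_def)
  qed
  moreover have "surj h"
  proof -
    have "\<exists>x. h x = y" for y
    proof -
      have "y \<in> p (i y) ` (f -` V (i y))" using pq i by (simp add: homeomorphism_def)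
      then obtain x where "y = p (i y) x" "f x \<in> V (i y)" by auto
      then have "h x = y" using h_on by metis
      then show ?thesis ..
    qed
    then show ?thesis by (metis surjI)
  qed
  ultimately obtain k where "homeomorphism UNIV UNIV h k"
    using homeomorphism_compact[OF compact_UNIV_cantor cont] by auto
  moreover have "dist (h x) (f x) < e" for x
  proof (rule U(2)[of _ "i (f x)"])
    have sub: "V (i (f x)) \<subseteq> U (i (f x))" unfolding V_def by (rule disjointed_subset)
    show "f x \<in> U (i (f x))" using i sub by blast
    have "h x \<in> V (i (f x))" using h_mem i by simp
    then show "h x \<in> U (i (f x))" using sub by blast
  qed
  ultimately show ?thesis using that by blast
qed

section \<open>Conjugates with small fibres\<close>

lemma continuous_in_bcontfun:
  fixes f :: "'a::cantor_space \<Rightarrow> 'a"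
  assumes "continuous_on UNIV f"
  shows "f \<in> bcontfun"
  using assms compact_continuous_image[OF assms compact_UNIV_cantor]
  by (simp add: bcontfun_def compact_imp_bounded)

lemma conj_classI:
  fixes f g :: "'a::cantor_space \<Rightarrow>\<^sub>C 'a"
  assumes "homeomorphism UNIV UNIV h k" "\<And>x. g x = h (f (k x))"
  shows "g \<in> conj_class f"
proof -
  have "h \<in> bcontfun" using assms(1) by (simp add: continuous_in_bcontfun homeomorphism_def)
  then obtain h' where h': "h = apply_bcontfun h'" by (rule bcontfunE)
  have "inv h = k" using assms(1) by (intro inv_equality) (auto simp: homeomorphism_def)
  then show ?thesis
    using assms h' by (auto simp: conj_class_def homeos_def fun_eq_iff intro!: bexI[of _ h'])
qed

lemma conj_classE:
  fixes f g :: "'a::cantor_space \<Rightarrow>\<^sub>C 'a"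
  assumes "g \<in> conj_class f"
  obtains h k where "homeomorphism UNIV UNIV h k" "\<And>x. g x = h (f (k x))"
proof -
  obtain h where h: "h \<in> homeos" "apply_bcontfun g = apply_bcontfun h \<circ> apply_bcontfun f \<circ> inv (apply_bcontfun h)"
    using assms by (auto simp: conj_class_def)
  then obtain k where k: "homeomorphism UNIV UNIV (apply_bcontfun h) k" by (auto simp: homeos_def)
  then have "inv (apply_bcontfun h) = k" by (intro inv_equality) (auto simp: homeomorphism_def)
  then show ?thesis using that[OF k] h by auto
qed

lemma conj_class_sym:
  fixes f g :: "'a::cantor_space \<Rightarrow>\<^sub>C 'a"
  assumes "g \<in> conj_class f"
  shows "f \<in> conj_class g"
proof -
  obtain h k where hk: "homeomorphism UNIV UNIV h k" "\<And>x. g x = h (f (k x))"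
    using conj_classE[OF assms] by blast
  show ?thesis
    by (rule conj_classI[OF homeomorphism_symD[OF hk(1)]]) (use hk in \<open>auto simp: homeomorphism_def\<close>)
qed

lemma conj_class_trans:
  fixes f g :: "'a::cantor_space \<Rightarrow>\<^sub>C 'a"
  assumes "g \<in> conj_class f" "g' \<in> conj_class g"
  shows "g' \<in> conj_class f"
proof -
  obtain h k where hk: "homeomorphism UNIV UNIV h k" "\<And>x. g x = h (f (k x))"
    using conj_classE[OF assms(1)] by blast
  obtain h' k' where hk': "homeomorphism UNIV UNIV h' k'" "\<And>x. g' x = h' (g (k' x))"
    using conj_classE[OF assms(2)] by blast
  show ?thesis
    by (rule conj_classI[OF homeomorphism_compose[OF hk(1) hk'(1)]]) (simp add: hk hk')
qed

lemma conj_class_homeos: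
  fixes f g :: "'a::cantor_space \<Rightarrow>\<^sub>C 'a"
  assumes "g \<in> homeos" "f \<in> conj_class g"
  shows "f \<in> homeos"
proof -
  obtain k where k: "homeomorphism UNIV UNIV (apply_bcontfun g) k"
    using assms(1) by (auto simp: homeos_def)
  obtain h l where hl: "homeomorphism UNIV UNIV h l" "\<And>x. f x = h (g (l x))"
    using conj_classE[OF assms(2)] by blast
  have "homeomorphism UNIV UNIV (h \<circ> (apply_bcontfun g \<circ> l)) ((h \<circ> k) \<circ> l)"
    by (rule homeomorphism_compose[OF homeomorphism_compose[OF homeomorphism_symD[OF hl(1)] k] hl(1)])
  moreover have "h \<circ> (apply_bcontfun g \<circ> l) = apply_bcontfun f" using hl(2) by auto
  ultimately show ?thesis by (auto simp: homeos_def)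
qed

text \<open>
  On a compact domain this says that the continuous map \<open>g\<close> has no fibre containing two points at
  distance at least \<open>e\<close>. The quantitative form with the uniform bound \<open>m\<close> makes openness immediate.
\<close>

definition separating :: "real \<Rightarrow> ('a::metric_space \<Rightarrow>\<^sub>C 'a) set" where
  "separating e = {g. \<exists>m>0. \<forall>x y. dist x y \<ge> e \<longrightarrow> dist (apply_bcontfun g x) (apply_bcontfun g y) \<ge> m}"

lemma open_separating: "open (separating e)"
  unfolding open_dist
proof
  fix g :: "'a \<Rightarrow>\<^sub>C 'a" assume "g \<in> separating e"
  then obtain m where m: "m > 0" "\<And>x y. dist x y \<ge> e \<Longrightarrow> dist (g x) (g y) \<ge> m"
    by (auto simp: separating_def)
  have "g' \<in> separating e" if "dist g' g < m / 3" for g'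
  proof -
    have "dist (g' x) (g' y) \<ge> m / 3" if "dist x y \<ge> e" for x y
      using m(2)[OF that] dist_fun_lt_imp_dist_val_lt[OF \<open>dist g' g < m/3\<close>, of x]
        dist_fun_lt_imp_dist_val_lt[OF \<open>dist g' g < m/3\<close>, of y]
        dist_triangle[of "g x" "g y" "g' x"] dist_triangle[of "g' x" "g y" "g' y"]
      by (simp add: dist_commute)
    then show ?thesis using m(1) by (auto simp: separating_def intro!: exI[of _ "m/3"])
  qed
  then show "\<exists>d>0. \<forall>g'. dist g' g < d \<longrightarrow> g' \<in> separating e"
    using m(1) by (intro exI[of _ "m/3"]) auto
qed

text \<open>
  With \<open>h\<close> a homeomorphism close to \<open>f\<close> and \<open>k\<close> its inverse, the point \<open>f (k x)\<close> is close to
  \<open>h (k x) = x\<close>. Therefore \<open>g = h \<circ> f \<circ> k\<close> is close to \<open>f\<close>, and if \<open>g x\<close> and \<open>g y\<close> are close, then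
  so are \<open>f (k x)\<close> and \<open>f (k y)\<close> by uniform continuity of \<open>k\<close>, hence also \<open>x\<close> and \<open>y\<close>.
\<close>

lemma separating_conjugate_nearby:
  fixes f :: "'a::cantor_space \<Rightarrow>\<^sub>C 'a"
  assumes "f \<in> Cs" "e > 0" "d > 0"
  obtains g where "g \<in> conj_class f" "g \<in> separating e" "dist g f < d"
proof -
  have "uniformly_continuous_on UNIV f"
    by (rule compact_uniformly_continuous[OF _ compact_UNIV_cantor]) simp
  then obtain r where r: "r > 0" "\<And>x y. dist x y < r \<Longrightarrow> dist (f x) (f y) < d / 4"
    using \<open>d > 0\<close> unfolding uniformly_continuous_on_def
    by (metis UNIV_I divide_pos_pos zero_less_numeral)
  \<comment> \<open>The bound \<open>d / 4\<close> serves \<open>h \<approx> f\<close>, the bound \<open>r\<close> serves \<open>f (f (k x)) \<approx> f x\<close>, and \<open>e / 4\<close> keeps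
    \<open>f \<circ> k\<close> from moving two points at distance \<open>e\<close> closer together than \<open>e / 2\<close>.\<close>
  define t where "t = min (d / 4) (min r (e / 4))"
  have t: "t > 0" "t \<le> d / 4" "t \<le> r" "t \<le> e / 4" using assms r by (auto simp: t_def)
  obtain h k where hk: "homeomorphism UNIV UNIV h k" "\<And>x. dist (h x) (f x) < t"
    using homeomorphism_near_surjection[of f t] assms(1) t(1) by (auto simp: Cs_def)
  have inv: "h (k x) = x" "k (h x) = x" for x using hk(1) by (auto simp: homeomorphism_def)
  have cont: "continuous_on UNIV h" "continuous_on UNIV k"
    using hk(1) by (auto simp: homeomorphism_def)
  have "continuous_on UNIV (\<lambda>x. h (f (k x)))"
    by (rule continuous_on_compose2[OF cont(1)], rule continuous_on_compose2[OF _ cont(2)]) auto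
  then have "(\<lambda>x. h (f (k x))) \<in> bcontfun" by (rule continuous_in_bcontfun)
  then obtain g where g: "(\<lambda>x. h (f (k x))) = apply_bcontfun g" by (rule bcontfunE)
  have g': "g x = h (f (k x))" for x using g by metis
  have moved: "dist x (f (k x)) < t" for x using hk(2)[of "k x"] by (simp add: inv)
  have "dist (g x) (f x) \<le> d / 2" for x
  proof -
    have "dist (f (f (k x))) (f x) < d / 4"
      using r(2)[of "f (k x)" x] moved[of x] t by (simp add: dist_commute)
    then show ?thesis
      using hk(2)[of "f (k x)"] t dist_triangle[of "g x" "f x" "f (f (k x))"] by (simp add: g')
  qed
  then have "dist g f \<le> d / 2" by (rule dist_bound)
  then have near: "dist g f < d" using \<open>d > 0\<close> by simp
  have "uniformly_continuous_on UNIV k"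
    by (rule compact_uniformly_continuous[OF cont(2) compact_UNIV_cantor])
  then obtain m where m: "m > 0" "\<And>x y. dist x y < m \<Longrightarrow> dist (k x) (k y) < e / 2"
    using \<open>e > 0\<close> unfolding uniformly_continuous_on_def
    by (metis UNIV_I half_gt_zero)
  have "dist (g x) (g y) \<ge> m" if "dist x y \<ge> e" for x y
  proof (rule ccontr)
    assume "\<not> dist (g x) (g y) \<ge> m"
    then have "dist (f (k x)) (f (k y)) < e / 2"
      using m(2)[of "g x" "g y"] by (simp add: g' inv)
    then show False
      using that moved[of x] moved[of y] t dist_triangle[of x y "f (k x)"]
        dist_triangle[of "f (k x)" y "f (k y)"] by (simp add: dist_commute)
  qed
  then have "g \<in> separating e" using m(1) by (auto simp: separating_def)
  then show ?thesis using that conj_classI[OF hk(1) g'] near by blast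
qed

section \<open>The category argument\<close>

text \<open>
  If surjections \<open>f\<close> converge uniformly to \<open>g\<close>, the values of \<open>g\<close> at preimages of \<open>y\<close> under \<open>f\<close>
  converge to \<open>y\<close>; the range of \<open>g\<close> is compact, so it contains \<open>y\<close>. Closedness keeps the closure of
  a conjugacy class inside \<open>Cs\<close>, where the \<open>G\<^sub>\<delta>\<close> hypothesis speaks.
\<close>

lemma closed_Cs: "closed (Cs :: ('a::cantor_space \<Rightarrow>\<^sub>C 'a) set)"
  unfolding closure_subset_eq[symmetric]
proof
  fix g :: "'a \<Rightarrow>\<^sub>C 'a"
  assume "g \<in> closure Cs"
  then have g: "\<forall>e>0. \<exists>f\<in>Cs. dist f g < e" by (simp add: closure_approachable)
  have "closed (range g)"
    by (intro compact_imp_closed compact_continuous_image compact_UNIV_cantor) simp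
  moreover have "y \<in> closure (range g)" for y
    unfolding closure_approachable
  proof (intro allI impI)
    fix e :: real assume "e > 0"
    then obtain f where f: "f \<in> Cs" "dist f g < e" using g by blast
    then obtain x where "y = f x" by (auto simp: Cs_def surj_def)
    then show "\<exists>z\<in>range g. dist z y < e"
      using dist_fun_lt_imp_dist_val_lt[OF f(2), of x] by (auto simp: dist_commute)
  qed
  ultimately show "g \<in> Cs" by (auto simp: Cs_def)
qed

text \<open>
  Baire's theorem is applied in the closure \<open>K\<close> of \<open>C\<close> to the open sets whose intersection is \<open>C\<close>
  together with the sets \<open>G n\<close>. The former contain \<open>C\<close> and the latter a dense subset of \<open>C\<close>, so
  all of them are dense in \<open>K\<close>.
\<close>

lemma gdelta_meets_dense_opens:
  fixes Y C :: "'a::complete_space set" and G :: "nat \<Rightarrow> 'a set"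
  assumes Y: "closed Y" and C: "gdelta_in (top_of_set Y) C" "C \<noteq> {}"
    and G: "\<And>n. open (G n)" "\<And>n. C \<subseteq> closure (C \<inter> G n)"
  shows "C \<inter> (\<Inter>n. G n) \<noteq> {}"
proof -
  define K where "K = closure C"
  have CK: "C \<subseteq> K" by (simp add: K_def closure_subset)
  have CY: "C \<subseteq> Y" using gdelta_in_subset[OF C(1)] by simp
  then have KY: "K \<subseteq> Y" unfolding K_def by (rule closure_minimal) (rule Y)
  obtain \<W> where \<W>: "countable \<W>" "\<And>T. T \<in> \<W> \<Longrightarrow> openin (top_of_set Y) T" "\<Inter>\<W> = C"
    using C(1) by (auto simp: gdelta_in_alt intersection_of_def)
  define \<G> where "\<G> = (\<lambda>T. K \<inter> T) ` \<W> \<union> range (\<lambda>n. K \<inter> G n)"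
  have "openin (top_of_set K) T \<and> top_of_set K closure_of T = topspace (top_of_set K)"
    if "T \<in> \<G>" for T
  proof -
    have "openin (top_of_set K) T"
      using that
    proof (unfold \<G>_def, elim UnE imageE)
      fix S assume S: "T = K \<inter> S" "S \<in> \<W>"
      then obtain S' where "open S'" "S = Y \<inter> S'" using \<W>(2) openin_open by metis
      then show ?thesis using S(1) KY openin_open by (metis inf_assoc inf.absorb1)
    next
      fix n assume "T = K \<inter> G n"
      then show ?thesis using G(1) by (simp add: openin_open_Int)
    qed
    moreover have "K \<subseteq> closure T"
    proof -
      have "C \<subseteq> closure T"
        using that
      proof (unfold \<G>_def, elim UnE imageE)
        fix S assume S: "T = K \<inter> S" "S \<in> \<W>"
        then have "C \<subseteq> T" using \<W>(3) CK by blast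
        then show ?thesis using closure_subset by blast
      next
        fix n assume "T = K \<inter> G n"
        then have "C \<inter> G n \<subseteq> T" using CK by blast
        then show ?thesis using G(2)[of n] closure_mono by blast
      qed
      then show ?thesis unfolding K_def by (rule closure_minimal) simp
    qed
    moreover have "T \<subseteq> K" using that by (auto simp: \<G>_def)
    ultimately show ?thesis by (auto simp: closure_of_subtopology Int_absorb1)
  qed
  moreover have "completely_metrizable_space (top_of_set K)"
    by (rule completely_metrizable_space_closedin[OF completely_metrizable_space_euclidean])
       (simp add: K_def)
  moreover have "countable \<G>" using \<W>(1) by (simp add: \<G>_def)
  ultimately have "top_of_set K closure_of \<Inter>\<G> = topspace (top_of_set K)"
    by (intro Baire_category) auto
  then have "\<Inter>\<G> \<noteq> {}" using C(2) CK by auto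
  then obtain g where g: "g \<in> \<Inter>\<G>" by blast
  then have "g \<in> C \<inter> (\<Inter>n. G n)" using \<W>(3) by (auto simp: \<G>_def)
  then show ?thesis by blast
qed

theorem theorem3p22:
  fixes f :: "'a::cantor_space \<Rightarrow>\<^sub>C 'a"
  assumes "f \<in> Cs"
    and "residual_type f"
  shows "f \<in> homeos"
proof -
  have G: "gdelta_in (top_of_set Cs) (conj_class f)" using assms(2) by (simp add: residual_type_def)
  then have sub: "conj_class f \<subseteq> Cs" using gdelta_in_subset by force
  have "f \<in> conj_class f" by (rule conj_classI[OF homeomorphism_ident]) simp
  moreover have "conj_class f \<subseteq> closure (conj_class f \<inter> separating (inverse (real (Suc n))))" for n
  proof
    fix g assume g: "g \<in> conj_class f"
    show "g \<in> closure (conj_class f \<inter> separating (inverse (real (Suc n))))"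
      unfolding closure_approachable
    proof (intro allI impI)
      fix d :: real assume "d > 0"
      then obtain g' where "g' \<in> conj_class g" "g' \<in> separating (inverse (real (Suc n)))" "dist g' g < d"
        using separating_conjugate_nearby[of g "inverse (real (Suc n))" d] g sub by auto
      then show "\<exists>y\<in>conj_class f \<inter> separating (inverse (real (Suc n))). dist y g < d"
        using conj_class_trans[OF g] by blast
    qed
  qed
  ultimately have "conj_class f \<inter> (\<Inter>n. separating (inverse (real (Suc n)))) \<noteq> {}"
    by (intro gdelta_meets_dense_opens[OF closed_Cs G] open_separating) auto
  then obtain g where g: "g \<in> conj_class f" "\<And>n. g \<in> separating (inverse (real (Suc n)))"
    by blast
  \<comment> \<open>Distinct points have distance more than some \<open>1/(n+1)\<close>, so \<open>g\<close> keeps them apart.\<close>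
  have "inj g"
  proof (rule injI, rule ccontr)
    fix x y assume eq: "g x = g y" and "x \<noteq> y"
    then obtain n where n: "inverse (real (Suc n)) < dist x y"
      using reals_Archimedean[of "dist x y"] by auto
    obtain m where "m > 0" "dist (g x) (g y) \<ge> m"
      using g(2)[of n] n unfolding separating_def by (force intro: less_imp_le)
    then show False using eq by simp
  qed
  moreover have "surj g" using g(1) sub by (auto simp: Cs_def)
  ultimately have "g \<in> homeos"
    using homeomorphism_compact[OF compact_UNIV_cantor, of g UNIV] by (auto simp: homeos_def)
  then show ?thesis using conj_class_sym[OF g(1)] conj_class_homeos by blast
qed

end
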